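(* Let $\mathscr H$ be a complex Hilbert space, let $\mathfrak M$ be a nonempty set of bounded self-adjoint operators on $\mathscr H$ that is bounded from below, and let $\mathfrak L$ be the set of all its lower bounds. Let $u\in\mathscr H$ be a unit vector and set $$\alpha:=\inf\{(Au,u):A\in\mathfrak M\},\quad \mathfrak M_u:=\{A\in\mathfrak M:(Au,u)=\alpha\},\quad \mathfrak L_u:=\{L\in\mathfrak L:(Lu,u)=\alpha\}.$$ Suppose that $\mathfrak M_u$ is not empty and that $Au=Bu$ for all $A,B\in\mathfrak M_u$. Let $B=\begin{pmatrix}\alpha & B_{12} \\ B_{12}^{*} & B_2\end{pmatrix}\in\mathfrak M_u$ and define $$\mathfrak M':=\bigl\{A_2-(a_1-\alpha)^{\#}(A_{12}-B_{12})^{*}(A_{12}-B_{12}) : A\in\mathfrak M\bigr\},$$ which does not depend on the choice of $B\in\mathfrak M_u$. An operator $L$ is an element of $\mathfrak L_u$ if and only if its block operator representation is of the form $$L=\begin{pmatrix}\alpha & B_{12} \\ B_{12}^{*} & L_2\end{pmatrix}$$ for some lower bound $L_2$ of $\mathfrak M'$. In particular, if $\mathfrak M'$ is not bounded from below, the set $\mathfrak L_u$ is empty.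
   Context: Bounded self-adjoint operators are ordered by Löwner's order: $S\le T$ iff $(Sv,v)\le (Tv,v)$ for all vectors $v$. A self-adjoint operator $L$ is a lower bound of a set $\mathfrak M$ of bounded self-adjoint operators if $L\le A$ for all $A\in\mathfrak M$; $\mathfrak M$ is bounded from below if it has a lower bound. Let $\mathscr H_1=\mathbb C u$ and $\mathscr H_2=\mathscr H_1^{\perp}$. Every bounded self-adjoint $S$ on $\mathscr H$ is written in block form $S=\begin{pmatrix}s_1 & S_{12} \\ S_{12}^{*} & S_2\end{pmatrix}$ with respect to $\mathscr H=\mathscr H_1\oplus\mathscr H_2$, where $s_1=(Su,u)$ is a real number, $S_{12}:\mathscr H_2\to\mathscr H_1$, and $S_2$ is bounded self-adjoint on $\mathscr H_2$; for $A\in\mathfrak M$ the blocks are $a_1,A_{12},A_2$. For a real number $t$, $t^{\#}$ is the Moore–Penrose inverse: $t^{\#}=t^{-1}$ if $t\neq0$ and $0^{\#}=0$. Lower bounds of $\mathfrak M'$ are taken among bounded self-adjoint operators on $\mathscr H_2$. *)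

theory Defs
  imports "HOL-Analysis.Analysis"
begin

text \<open>The inner product is linear in its first argument.\<close>

class complex_inner_space = real_normed_vector +
  fixes scaleC :: "complex \<Rightarrow> 'a \<Rightarrow> 'a" (infixr "*\<^sub>C" 75)
    and cinner :: "'a \<Rightarrow> 'a \<Rightarrow> complex"
  assumes scaleC_add_right: "c *\<^sub>C (x + y) = c *\<^sub>C x + c *\<^sub>C y"
    and scaleC_add_left: "(c + d) *\<^sub>C x = c *\<^sub>C x + d *\<^sub>C x"
    and scaleC_scaleC: "c *\<^sub>C (d *\<^sub>C x) = (c * d) *\<^sub>C x"
    and scaleC_of_real: "complex_of_real r *\<^sub>C x = r *\<^sub>R x"
    and cinner_commute: "cinner x y = cnj (cinner y x)"
    and cinner_add_left: "cinner (x + y) z = cinner x z + cinner y z"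
    and cinner_scaleC_left: "cinner (c *\<^sub>C x) y = c * cinner x y"
    and cinner_self_nonneg: "0 \<le> Re (cinner x x)"
    and cinner_self_eq_zero: "cinner x x = 0 \<longleftrightarrow> x = 0"
    and norm_eq_sqrt_cinner: "norm x = sqrt (Re (cinner x x))"

class complex_hilbert_space = complex_inner_space + complete_space

instantiation complex :: complex_hilbert_space
begin

definition scaleC_complex :: "complex \<Rightarrow> complex \<Rightarrow> complex"
  where "scaleC_complex c x = c * x"

definition cinner_complex :: "complex \<Rightarrow> complex \<Rightarrow> complex"
  where "cinner_complex x y = x * cnj y"

instance
proof
  fix x :: complex
  show "norm x = sqrt (Re (cinner x x))"
    by (simp add: cinner_complex_def cmod_def power2_eq_square)
qed (auto simp: scaleC_complex_def cinner_complex_def scaleR_conv_of_real algebra_simps)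

end

text \<open>
  An operator from a subspace \<open>K\<close> to a subspace \<open>N\<close> is an extensional function: it takes the
  value \<open>undefined\<close> outside \<open>K\<close>, so that equality of functions is equality of operators.
  For operators on the whole space, \<open>K = UNIV\<close>, this is no restriction.
\<close>

definition bounded_operator ::
  "'a::complex_inner_space set \<Rightarrow> 'a set \<Rightarrow> ('a \<Rightarrow> 'a) \<Rightarrow> bool"
  where "bounded_operator K N T \<longleftrightarrow>
    T \<in> K \<rightarrow>\<^sub>E N \<and>
    (\<forall>x\<in>K. \<forall>y\<in>K. T (x + y) = T x + T y) \<and>
    (\<forall>c. \<forall>x\<in>K. T (c *\<^sub>C x) = c *\<^sub>C T x) \<and>
    (\<exists>C. \<forall>x\<in>K. norm (T x) \<le> C * norm x)"

text \<open>
  The adjoint is unique whenever it exists; it does exist for a bounded operator between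
  closed subspaces of a Hilbert space.
\<close>

definition op_adjoint ::
  "'a::complex_inner_space set \<Rightarrow> 'a set \<Rightarrow> ('a \<Rightarrow> 'a) \<Rightarrow> 'a \<Rightarrow> 'a"
  where "op_adjoint K N T = (THE S. bounded_operator N K S \<and>
    (\<forall>x\<in>K. \<forall>y\<in>N. cinner (T x) y = cinner x (S y)))"

definition bounded_selfadjoint :: "'a::complex_inner_space set \<Rightarrow> ('a \<Rightarrow> 'a) \<Rightarrow> bool"
  where "bounded_selfadjoint K T \<longleftrightarrow> bounded_operator K K T \<and>
    (\<forall>x\<in>K. \<forall>y\<in>K. cinner (T x) y = cinner x (T y))"

text \<open>For self-adjoint operators the quadratic forms below are real; \<open>Re\<close> only changes the type.\<close>

definition loewner_le ::
  "'a::complex_inner_space set \<Rightarrow> ('a \<Rightarrow> 'a) \<Rightarrow> ('a \<Rightarrow> 'a) \<Rightarrow> bool"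
  where "loewner_le K S T \<longleftrightarrow> (\<forall>v\<in>K. Re (cinner (S v) v) \<le> Re (cinner (T v) v))"

definition lower_bounds :: "'a::complex_inner_space set \<Rightarrow> ('a \<Rightarrow> 'a) set \<Rightarrow> ('a \<Rightarrow> 'a) set"
  where "lower_bounds K \<MM> = {L. bounded_selfadjoint K L \<and> (\<forall>A\<in>\<MM>. loewner_le K L A)}"

definition bounded_from_below :: "'a::complex_inner_space set \<Rightarrow> ('a \<Rightarrow> 'a) set \<Rightarrow> bool"
  where "bounded_from_below K \<MM> \<longleftrightarrow> lower_bounds K \<MM> \<noteq> {}"

text \<open>In the following, \<open>u\<close> is a unit vector.\<close>

definition H1 :: "'a::complex_inner_space \<Rightarrow> 'a set"
  where "H1 u = range (\<lambda>c. c *\<^sub>C u)"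

definition H2 :: "'a::complex_inner_space \<Rightarrow> 'a set"
  where "H2 u = {x. \<forall>y\<in>H1 u. cinner x y = 0}"

definition proj1 :: "'a::complex_inner_space \<Rightarrow> 'a \<Rightarrow> 'a"
  where "proj1 u x = cinner x u *\<^sub>C u"

definition proj2 :: "'a::complex_inner_space \<Rightarrow> 'a \<Rightarrow> 'a"
  where "proj2 u x = x - proj1 u x"

definition block1 :: "'a::complex_inner_space \<Rightarrow> ('a \<Rightarrow> 'a) \<Rightarrow> real"
  where "block1 u S = Re (cinner (S u) u)"

definition block12 :: "'a::complex_inner_space \<Rightarrow> ('a \<Rightarrow> 'a) \<Rightarrow> 'a \<Rightarrow> 'a"
  where "block12 u S = (\<lambda>x\<in>H2 u. proj1 u (S x))"

definition block2 :: "'a::complex_inner_space \<Rightarrow> ('a \<Rightarrow> 'a) \<Rightarrow> 'a \<Rightarrow> 'a"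
  where "block2 u S = (\<lambda>x\<in>H2 u. proj2 u (S x))"

text \<open>
  The operator with block matrix
  \<open>(s\<^sub>1, S\<^sub>1\<^sub>2; S\<^sub>1\<^sub>2\<^sup>*, S\<^sub>2)\<close>
  with respect to \<open>H1 u \<oplus> H2 u\<close>.
\<close>

definition block_op ::
  "'a::complex_inner_space \<Rightarrow> real \<Rightarrow> ('a \<Rightarrow> 'a) \<Rightarrow> ('a \<Rightarrow> 'a) \<Rightarrow> 'a \<Rightarrow> 'a"
  where "block_op u s1 S12 S2 = (\<lambda>x.
    (complex_of_real s1 *\<^sub>C proj1 u x + S12 (proj2 u x)) +
    (op_adjoint (H2 u) (H1 u) S12 (proj1 u x) + S2 (proj2 u x)))"

definition mp_inverse :: "real \<Rightarrow> real"
  where "mp_inverse t = (if t = 0 then 0 else inverse t)"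

text \<open>The operator \<open>A\<^sub>2 - (a\<^sub>1 - \<alpha>)\<^sup># (A\<^sub>1\<^sub>2 - B\<^sub>1\<^sub>2)\<^sup>* (A\<^sub>1\<^sub>2 - B\<^sub>1\<^sub>2)\<close> on \<open>H2 u\<close>.\<close>

definition reduced_op ::
  "'a::complex_inner_space \<Rightarrow> real \<Rightarrow> ('a \<Rightarrow> 'a) \<Rightarrow> ('a \<Rightarrow> 'a) \<Rightarrow> 'a \<Rightarrow> 'a"
  where "reduced_op u \<alpha> B A =
    (let D = (\<lambda>x\<in>H2 u. block12 u A x - block12 u B x)
     in (\<lambda>x\<in>H2 u. block2 u A x -
          complex_of_real (mp_inverse (block1 u A - \<alpha>)) *\<^sub>C op_adjoint (H2 u) (H1 u) D (D x)))"

end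

theory Submission
  imports Defs
begin

text \<open>
  Two facts about nonnegative forms carry the proof.

  If \<open>L\<close> is a lower bound with \<open>(L u, u) = \<alpha>\<close> and \<open>B\<close> attains the infimum, then
  \<open>B - L\<close> is nonnegative and its form vanishes at \<open>u\<close>, which forces \<open>L u = B u\<close>
  (\<open>loewner_le_form_eq_imp_eq\<close>). For a self-adjoint operator \<open>S\<close>, the vector \<open>S u\<close> determines
  both the corner entry and the off-diagonal entries of the block matrix (\<open>block12_selfadjoint\<close>,
  \<open>block_op_blocks\<close>), so these entries of \<open>L\<close> agree with those of \<open>B\<close>, and only the block
  \<open>L\<^sub>2\<close> remains free.

  For \<open>L\<close> with \<open>L u = B u\<close> and \<open>A \<in> \<MM>\<close>, the form of \<open>A - L\<close> at \<open>c u + x\<close>, with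
  \<open>x\<close> orthogonal to \<open>u\<close>, is
  \<open>(a\<^sub>1 - \<alpha>) |c|\<^sup>2 + 2 Re (c ((A - B) u, x)) + ((A\<^sub>2 - L\<^sub>2) x, x)\<close>.
  Here \<open>a\<^sub>1 - \<alpha>\<close> is nonnegative, and if it is zero then \<open>A\<close> attains the infimum too and the
  linear term vanishes by the assumption that all minimizers agree at \<open>u\<close>. Minimizing over \<open>c\<close>
  therefore shows that \<open>L \<le> A\<close> holds iff \<open>L\<^sub>2\<close> lies below the Schur complement
  \<open>A\<^sub>2 - (a\<^sub>1 - \<alpha>)\<^sup># (A\<^sub>1\<^sub>2 - B\<^sub>1\<^sub>2)\<^sup>* (A\<^sub>1\<^sub>2 - B\<^sub>1\<^sub>2)\<close> (\<open>loewner_le_iff_reduced\<close>), that is, that the lower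
  bounds \<open>L\<close> with \<open>L u = B u\<close> correspond exactly to the lower bounds \<open>L\<^sub>2\<close> of \<open>\<MM>'\<close>.
\<close>

section \<open>Complex inner product spaces\<close>

lemma scaleC_zero_left [simp]: "0 *\<^sub>C x = (0::'a::complex_inner_space)"
  using scaleC_of_real[of 0 x] by simp

lemma scaleC_one [simp]: "1 *\<^sub>C x = (x::'a::complex_inner_space)"
  using scaleC_of_real[of 1 x] by simp

lemma scaleC_zero_right [simp]: "c *\<^sub>C 0 = (0::'a::complex_inner_space)"
  using scaleC_add_right[of c 0 0] by simp

lemma scaleC_minus_right: "c *\<^sub>C (- x) = - (c *\<^sub>C (x::'a::complex_inner_space))"
  using scaleC_add_right[of c x "- x"] by (simp add: eq_neg_iff_add_eq_0 add.commute)

lemma scaleC_diff_right: "c *\<^sub>C (x - y) = c *\<^sub>C x - c *\<^sub>C (y::'a::complex_inner_space)"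
  using scaleC_add_right[of c x "- y"] by (simp add: scaleC_minus_right)

lemma scaleC_diff_left: "(c - d) *\<^sub>C x = c *\<^sub>C x - d *\<^sub>C (x::'a::complex_inner_space)"
  using scaleC_add_left[of "c - d" d x] by (simp add: algebra_simps)

lemma scaleC_minus_one: "(-1) *\<^sub>C x = - (x::'a::complex_inner_space)"
  using scaleC_of_real[of "-1" x] by simp

lemma cinner_zero_left [simp]: "cinner 0 (x::'a::complex_inner_space) = 0"
  using cinner_add_left[of 0 0 x] by simp

lemma cinner_minus_left: "cinner (- x) y = - cinner (x::'a::complex_inner_space) y"
  using cinner_scaleC_left[of "-1" x y] by (simp add: scaleC_minus_one)

lemma cinner_diff_left: "cinner (x - y) z = cinner x z - cinner (y::'a::complex_inner_space) z"
  using cinner_add_left[of x "- y" z] by (simp add: cinner_minus_left)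

lemma cinner_add_right: "cinner x (y + z) = cinner x y + cinner (x::'a::complex_inner_space) z"
  by (metis cinner_add_left cinner_commute complex_cnj_add)

lemma cinner_diff_right: "cinner x (y - z) = cinner x y - cinner (x::'a::complex_inner_space) z"
  by (metis cinner_diff_left cinner_commute complex_cnj_diff)

lemma cinner_scaleC_right: "cinner x (c *\<^sub>C y) = cnj c * cinner (x::'a::complex_inner_space) y"
  by (metis cinner_scaleC_left cinner_commute complex_cnj_mult)

lemma cinner_self: "cinner x x = complex_of_real ((norm (x::'a::complex_inner_space))\<^sup>2)"
proof -
  have "Im (cinner x x) = 0"
    using arg_cong[OF cinner_commute[of x x], of Im] by simp
  then show ?thesis
    by (simp add: complex_eq_iff norm_eq_sqrt_cinner cinner_self_nonneg)
qed

lemma cinner_ext: "(\<And>w. cinner x w = cinner y w) \<Longrightarrow> x = (y::'a::complex_inner_space)"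
  by (metis cinner_diff_left cinner_self_eq_zero eq_iff_diff_eq_0)

lemma norm_scaleC: "norm (c *\<^sub>C x) = cmod c * norm (x::'a::complex_inner_space)"
proof -
  have "cinner (c *\<^sub>C x) (c *\<^sub>C x) = (c * cnj c) * cinner x x"
    by (simp add: cinner_scaleC_left cinner_scaleC_right)
  then have "complex_of_real ((norm (c *\<^sub>C x))\<^sup>2) = complex_of_real ((cmod c * norm x)\<^sup>2)"
    by (simp add: cinner_self complex_norm_square[symmetric] power_mult_distrib)
  then have "(norm (c *\<^sub>C x))\<^sup>2 = (cmod c * norm x)\<^sup>2"
    by (simp only: of_real_eq_iff)
  then show ?thesis
    by simp
qed

section \<open>Nonnegative quadratic polynomials\<close>

text \<open>A nonzero linear term is unbounded below.\<close>

lemma linear_form_nonneg_imp_zero: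
  fixes z :: complex and r :: real
  assumes "\<And>c. 0 \<le> 2 * Re (c * z) + r"
  shows "z = 0"
proof (rule ccontr)
  assume "z \<noteq> 0"
  \<comment> \<open>With \<open>c = - k * cnj z\<close> and this \<open>k\<close>, the polynomial takes the value \<open>-1\<close>.\<close>
  define k where "k = (r + 1) / (2 * (cmod z)\<^sup>2)"
  have form: "Re (- complex_of_real k * cnj z * z) = - (k * (cmod z)\<^sup>2)"
    unfolding cmod_power2 by (simp add: power2_eq_square algebra_simps)
  have k: "k * (cmod z)\<^sup>2 = (r + 1) / 2"
    using \<open>z \<noteq> 0\<close> by (simp add: k_def)
  have "2 * Re (- complex_of_real k * cnj z * z) + r = - 1"
    unfolding form k by (simp add: field_simps)
  with assms[of "- complex_of_real k * cnj z"] show False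
    by linarith
qed

text \<open>Division by zero yields zero in HOL, so it agrees with the Moore--Penrose inverse.\<close>

lemma mp_inverse_mult: "mp_inverse t * y = y / t"
  by (simp add: mp_inverse_def divide_inverse)

text \<open>
  Completing the square: the polynomial is \<open>cmod (t * c + cnj z)\<^sup>2 / t + (r - cmod z\<^sup>2 / t)\<close>,
  with minimum attained at \<open>c = - cnj z / t\<close>.
\<close>

lemma quadratic_form_nonneg_iff:
  fixes z :: complex and r t :: real
  assumes "0 \<le> t" and "t = 0 \<Longrightarrow> z = 0"
  shows "(\<forall>c. 0 \<le> t * (cmod c)\<^sup>2 + 2 * Re (c * z) + r) \<longleftrightarrow> mp_inverse t * (cmod z)\<^sup>2 \<le> r"
proof (cases "t = 0")
  case True
  then show ?thesis
    using assms by (simp add: mp_inverse_def)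
next
  case False
  then have t: "0 < t"
    using assms by simp
  have square: "t * (cmod c)\<^sup>2 + 2 * Re (c * z) + (cmod z)\<^sup>2 / t
      = (cmod (of_real t * c + cnj z))\<^sup>2 / t" for c
  proof -
    have "(cmod (of_real t * c + cnj z))\<^sup>2
        = t * (t * (cmod c)\<^sup>2 + 2 * Re (c * z)) + (cmod z)\<^sup>2"
      unfolding cmod_power2 by (simp add: power2_eq_square algebra_simps)
    then show ?thesis
      using t by (simp add: add_divide_distrib)
  qed
  show ?thesis
  proof
    assume "\<forall>c. 0 \<le> t * (cmod c)\<^sup>2 + 2 * Re (c * z) + r"
    then have "0 \<le> t * (cmod (- cnj z / of_real t))\<^sup>2 + 2 * Re (- cnj z / of_real t * z) + r"
      by blast
    moreover have "(cmod (of_real t * (- cnj z / of_real t) + cnj z))\<^sup>2 / t = 0"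
      using t by simp
    ultimately show "mp_inverse t * (cmod z)\<^sup>2 \<le> r"
      unfolding mp_inverse_mult using square[of "- cnj z / of_real t"] by linarith
  next
    assume "mp_inverse t * (cmod z)\<^sup>2 \<le> r"
    then have r: "(cmod z)\<^sup>2 / t \<le> r"
      by (simp only: mp_inverse_mult)
    show "\<forall>c. 0 \<le> t * (cmod c)\<^sup>2 + 2 * Re (c * z) + r"
    proof
      fix c
      have "0 \<le> (cmod (of_real t * c + cnj z))\<^sup>2 / t"
        using t by simp
      with square[of c] r show "0 \<le> t * (cmod c)\<^sup>2 + 2 * Re (c * z) + r"
        by linarith
    qed
  qed
qed

text \<open>The Cauchy--Schwarz inequality is the bound on the minimum of \<open>norm (c *\<^sub>C x + y)\<^sup>2\<close>.\<close>

lemma cinner_Cauchy_Schwarz: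
  "cmod (cinner x y) \<le> norm x * norm (y::'a::complex_inner_space)"
proof -
  have "(norm (c *\<^sub>C x + y))\<^sup>2 = (norm x)\<^sup>2 * (cmod c)\<^sup>2 + 2 * Re (c * cinner x y) + (norm y)\<^sup>2" for c
  proof -
    have "complex_of_real ((norm (c *\<^sub>C x + y))\<^sup>2) = (c * cnj c) * cinner x x
        + (c * cinner x y + cnj (c * cinner x y)) + cinner y y"
      unfolding cinner_self[symmetric] complex_cnj_mult cinner_commute[of x y, symmetric]
      by (simp add: cinner_add_left cinner_add_right cinner_scaleC_left cinner_scaleC_right
          cinner_commute[of y x] algebra_simps)
    also have "\<dots> = complex_of_real
        ((norm x)\<^sup>2 * (cmod c)\<^sup>2 + 2 * Re (c * cinner x y) + (norm y)\<^sup>2)"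
      unfolding cinner_self complex_add_cnj complex_norm_square[symmetric] by simp
    finally show ?thesis
      by (simp only: of_real_eq_iff)
  qed
  then have nonneg: "\<forall>c. 0 \<le> (norm x)\<^sup>2 * (cmod c)\<^sup>2 + 2 * Re (c * cinner x y) + (norm y)\<^sup>2"
    by (metis zero_le_power2)
  have "mp_inverse ((norm x)\<^sup>2) * (cmod (cinner x y))\<^sup>2 \<le> (norm y)\<^sup>2"
    using quadratic_form_nonneg_iff[of "(norm x)\<^sup>2" "cinner x y" "(norm y)\<^sup>2"] nonneg by auto
  then have "(cmod (cinner x y))\<^sup>2 / (norm x)\<^sup>2 \<le> (norm y)\<^sup>2"
    by (simp only: mp_inverse_mult)
  then have "(cmod (cinner x y))\<^sup>2 \<le> (norm x * norm y)\<^sup>2"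
    by (cases "x = 0") (simp_all add: pos_divide_le_eq power_mult_distrib mult.commute)
  then show ?thesis
    by (rule power2_le_imp_le) simp
qed

section \<open>Self-adjoint operators\<close>

lemma bounded_selfadjointD:
  assumes "bounded_selfadjoint K S" and "x \<in> K"
  shows "S x \<in> K"
    and "y \<in> K \<Longrightarrow> S (x + y) = S x + S y"
    and "S (c *\<^sub>C x) = c *\<^sub>C S x"
    and "y \<in> K \<Longrightarrow> cinner (S x) y = cinner x (S y)"
  using assms(2) assms(1)[unfolded bounded_selfadjoint_def bounded_operator_def]
  by (metis PiE_mem)+

lemma bounded_selfadjoint_extensional:
  "bounded_selfadjoint K S \<Longrightarrow> S \<in> extensional K"
  unfolding bounded_selfadjoint_def bounded_operator_def by (auto simp: PiE_def)

lemma bounded_selfadjoint_bound: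
  assumes "bounded_selfadjoint K S"
  obtains C where "0 \<le> C" and "\<And>x. x \<in> K \<Longrightarrow> norm (S x) \<le> C * norm x"
proof -
  from assms obtain C where C: "\<And>x. x \<in> K \<Longrightarrow> norm (S x) \<le> C * norm x"
    unfolding bounded_selfadjoint_def bounded_operator_def by blast
  have "norm (S x) \<le> \<bar>C\<bar> * norm x" if "x \<in> K" for x
    using C[OF that] by (meson abs_ge_self mult_right_mono norm_ge_zero order_trans)
  then show thesis
    using that[of "\<bar>C\<bar>"] by simp
qed

lemma bounded_selfadjoint_UNIV_diff:
  assumes A: "bounded_selfadjoint UNIV A" and L: "bounded_selfadjoint UNIV L"
  shows "bounded_selfadjoint UNIV (\<lambda>x. A x - L x)"
proof -
  from bounded_selfadjoint_bound[OF A] obtain C where C: "\<And>x. norm (A x) \<le> C * norm x"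
    by auto
  from bounded_selfadjoint_bound[OF L] obtain D where D: "\<And>x. norm (L x) \<le> D * norm x"
    by auto
  have "norm (A x - L x) \<le> (C + D) * norm x" for x
    using norm_triangle_ineq4[of "A x" "L x"] C[of x] D[of x] by (simp add: algebra_simps)
  then show ?thesis
    unfolding bounded_selfadjoint_def bounded_operator_def
    using bounded_selfadjointD[OF A] bounded_selfadjointD[OF L]
    by (auto simp: scaleC_diff_right cinner_diff_left cinner_diff_right)
qed

text \<open>
  By self-adjointness the two mixed terms are complex conjugates of each other, so their sum is
  twice a real part.
\<close>

lemma selfadjoint_quadratic_form:
  assumes S: "bounded_selfadjoint UNIV S"
  shows "Re (cinner (S (c *\<^sub>C u + x)) (c *\<^sub>C u + x))
    = Re (cinner (S u) u) * (cmod c)\<^sup>2 + 2 * Re (c * cinner (S u) x) + Re (cinner (S x) x)"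
proof -
  note S = bounded_selfadjointD[OF S, simplified]
  have "cinner (S x) u = cnj (cinner (S u) x)"
    using S(4)[of x u] cinner_commute[of x "S u"] by simp
  then have "cinner (S (c *\<^sub>C u + x)) (c *\<^sub>C u + x) =
      cinner (S u) u * of_real ((cmod c)\<^sup>2) + (c * cinner (S u) x + cnj (c * cinner (S u) x))
      + cinner (S x) x"
    unfolding complex_norm_square
    by (simp add: S(2,3) cinner_add_left cinner_add_right cinner_scaleC_left cinner_scaleC_right
        algebra_simps)
  then show ?thesis
    by (simp add: complex_add_cnj)
qed

text \<open>
  If \<open>A - L\<close> is nonnegative, then at a vector \<open>u\<close> where its form vanishes, the form on
  \<open>c *\<^sub>C u + x\<close> has no quadratic term in \<open>c\<close>; hence the linear term vanishes for all \<open>x\<close>.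
\<close>

lemma loewner_le_form_eq_imp_eq:
  assumes A: "bounded_selfadjoint UNIV A" and L: "bounded_selfadjoint UNIV L"
    and le: "loewner_le UNIV L A"
    and eq: "Re (cinner (L u) u) = Re (cinner (A u) u)"
  shows "L u = A u"
proof (rule cinner_ext)
  fix w
  define E where "E = (\<lambda>x. A x - L x)"
  have E: "bounded_selfadjoint UNIV E"
    unfolding E_def by (rule bounded_selfadjoint_UNIV_diff[OF A L])
  have "0 \<le> Re (cinner (E v) v)" for v
    using le by (simp add: loewner_le_def E_def cinner_diff_left)
  then have "0 \<le> 2 * Re (c * cinner (E u) w) + Re (cinner (E w) w)" for c
    using selfadjoint_quadratic_form[OF E, of c u w] eq
    by (metis E_def add_0 cinner_diff_left diff_self minus_complex.sel(1) mult_zero_left)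
  then have "cinner (E u) w = 0"
    by (rule linear_form_nonneg_imp_zero)
  then show "cinner (L u) w = cinner (A u) w"
    by (simp add: E_def cinner_diff_left)
qed

section \<open>Block operators\<close>

lemma H2_iff: "x \<in> H2 u \<longleftrightarrow> cinner x u = 0"
proof
  assume "x \<in> H2 u"
  moreover have "u \<in> H1 u"
    unfolding H1_def by (metis rangeI scaleC_one)
  ultimately show "cinner x u = 0"
    unfolding H2_def by blast
qed (auto simp: H2_def H1_def cinner_scaleC_right)

lemma H2_iff': "x \<in> H2 u \<longleftrightarrow> cinner u x = 0"
  by (metis H2_iff cinner_commute complex_cnj_zero_iff)

lemma H2_add: "x \<in> H2 u \<Longrightarrow> y \<in> H2 u \<Longrightarrow> x + y \<in> H2 u"
  by (simp add: H2_iff cinner_add_left)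

lemma H2_diff: "x \<in> H2 u \<Longrightarrow> y \<in> H2 u \<Longrightarrow> x - y \<in> H2 u"
  by (simp add: H2_iff cinner_diff_left)

lemma H2_scaleC: "x \<in> H2 u \<Longrightarrow> c *\<^sub>C x \<in> H2 u"
  by (simp add: H2_iff cinner_scaleC_left)

lemma cinner_unit: "norm u = 1 \<Longrightarrow> cinner u u = 1"
  by (simp add: cinner_self)

lemma H1_scaleC: "c *\<^sub>C u \<in> H1 u"
  by (simp add: H1_def)

lemma proj2_in_H2: "norm u = 1 \<Longrightarrow> proj2 u x \<in> H2 u"
  by (simp add: proj2_def proj1_def H2_iff cinner_diff_left cinner_scaleC_left cinner_unit)

lemma proj2_of_H2: "x \<in> H2 u \<Longrightarrow> proj2 u x = x"
  by (simp add: proj2_def proj1_def H2_iff)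

lemma proj_decomposition: "cinner x u *\<^sub>C u + proj2 u x = x"
  by (simp add: proj2_def proj1_def)

lemma proj2_add: "proj2 u (x + y) = proj2 u x + proj2 u y"
  by (simp add: proj2_def proj1_def cinner_add_left scaleC_add_left)

lemma proj2_diff: "proj2 u (x - y) = proj2 u x - proj2 u y"
  by (simp add: proj2_def proj1_def cinner_diff_left scaleC_diff_left)

lemma proj2_scaleC: "proj2 u (c *\<^sub>C x) = c *\<^sub>C proj2 u x"
  by (simp add: proj2_def proj1_def cinner_scaleC_left scaleC_diff_right scaleC_scaleC)

lemma cinner_proj2_left: "y \<in> H2 u \<Longrightarrow> cinner (proj2 u x) y = cinner x y"
  by (simp add: proj2_def proj1_def cinner_diff_left cinner_scaleC_left H2_iff')

lemma cinner_proj2_right: "y \<in> H2 u \<Longrightarrow> cinner y (proj2 u x) = cinner y x"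
  by (metis cinner_commute cinner_proj2_left)

lemma norm_proj2_le:
  assumes "norm u = 1"
  shows "norm (proj2 u x) \<le> 2 * norm x"
proof -
  have "norm (proj1 u x) \<le> norm x"
    using cinner_Cauchy_Schwarz[of x u] assms by (simp add: proj1_def norm_scaleC)
  then show ?thesis
    unfolding proj2_def using norm_triangle_ineq4[of x "proj1 u x"] by linarith
qed

text \<open>
  The identity \<open>((x, b) u, c u) = (x, c b)\<close> for \<open>x \<in> H2 u\<close> shows that the adjoint sends \<open>c u\<close>
  to \<open>c b\<close>; that \<open>b\<close> lies in \<open>H2 u\<close> makes it a map into \<open>H2 u\<close> and gives uniqueness.
\<close>

lemma op_adjoint_rank_one:
  assumes unit: "norm u = 1" and b: "b \<in> H2 u"
  shows "op_adjoint (H2 u) (H1 u) (\<lambda>x\<in>H2 u. cinner x b *\<^sub>C u) = (\<lambda>y\<in>H1 u. cinner y u *\<^sub>C b)"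
  unfolding op_adjoint_def
proof (rule the_equality)
  let ?S = "\<lambda>y\<in>H1 u. cinner y u *\<^sub>C b"
  have add: "x + y \<in> H1 u" if "x \<in> H1 u" "y \<in> H1 u" for x y
    using that by (auto simp: H1_def scaleC_add_left[symmetric])
  have scale: "c *\<^sub>C x \<in> H1 u" if "x \<in> H1 u" for c x
    using that by (auto simp: H1_def scaleC_scaleC)
  have bound: "norm (?S y) \<le> norm b * norm y" if "y \<in> H1 u" for y
    using that mult_right_mono[OF cinner_Cauchy_Schwarz[of y u] norm_ge_zero[of b]] unit
    by (simp add: norm_scaleC mult.commute)
  have "bounded_operator (H1 u) (H2 u) ?S"
    unfolding bounded_operator_def
  proof (intro conjI)
    show "?S \<in> H1 u \<rightarrow>\<^sub>E H2 u"
      using b by (auto intro: H2_scaleC)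
    show "\<exists>C. \<forall>x\<in>H1 u. norm (?S x) \<le> C * norm x"
      using bound by blast
  qed (auto simp: add scale cinner_add_left scaleC_add_left cinner_scaleC_left scaleC_scaleC)
  moreover have "cinner (cinner x b *\<^sub>C u) y = cinner x (?S y)" if "y \<in> H1 u" for x y
    using that by (auto simp: H1_def cinner_scaleC_left cinner_scaleC_right cinner_unit[OF unit])
  ultimately show "bounded_operator (H1 u) (H2 u) ?S \<and>
      (\<forall>x\<in>H2 u. \<forall>y\<in>H1 u. cinner ((\<lambda>x\<in>H2 u. cinner x b *\<^sub>C u) x) y = cinner x (?S y))"
    by simp
next
  fix S
  assume S: "bounded_operator (H1 u) (H2 u) S \<and>
      (\<forall>x\<in>H2 u. \<forall>y\<in>H1 u. cinner ((\<lambda>x\<in>H2 u. cinner x b *\<^sub>C u) x) y = cinner x (S y))"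
  then have ext: "S \<in> H1 u \<rightarrow>\<^sub>E H2 u"
    by (simp add: bounded_operator_def)
  \<comment> \<open>Both \<open>S y\<close> and the claimed value lie in \<open>H2 u\<close>, and testing their difference \<open>w\<close> against
    either of them gives the same number; hence \<open>w\<close> is orthogonal to itself.\<close>
  have "S y = cinner y u *\<^sub>C b" if y: "y \<in> H1 u" for y
  proof -
    let ?w = "S y - cinner y u *\<^sub>C b"
    have w: "?w \<in> H2 u"
      using ext y b by (auto intro: H2_diff H2_scaleC)
    then have "cinner ?w (S y) = cinner ?w b * cinner u y"
      using S y by (simp add: cinner_scaleC_left)
    also have "\<dots> = cinner ?w (cinner y u *\<^sub>C b)"
      by (simp add: cinner_scaleC_right cinner_commute[of u y])
    finally have "cinner ?w ?w = 0"
      by (simp add: cinner_diff_right)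
    then show ?thesis
      by (simp add: cinner_self_eq_zero)
  qed
  then show "S = (\<lambda>y\<in>H1 u. cinner y u *\<^sub>C b)"
    using ext by (intro extensionalityI[of _ "H1 u"]) (auto simp: PiE_def)
qed

text \<open>By self-adjointness, \<open>(S x, u) = (x, S u)\<close>, so \<open>S u\<close> determines the off-diagonal block.\<close>

lemma block12_selfadjoint:
  assumes "bounded_selfadjoint UNIV S"
  shows "block12 u S = (\<lambda>x\<in>H2 u. cinner x (proj2 u (S u)) *\<^sub>C u)"
  unfolding block12_def
  using bounded_selfadjointD(4)[OF assms] by (auto simp: proj1_def cinner_proj2_right)

lemma block2_selfadjoint:
  assumes unit: "norm u = 1" and S: "bounded_selfadjoint UNIV S"
  shows "bounded_selfadjoint (H2 u) (block2 u S)"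
proof -
  note D = bounded_selfadjointD[OF S, simplified]
  from bounded_selfadjoint_bound[OF S] obtain C where C: "\<And>x. norm (S x) \<le> C * norm x"
    by auto
  have "norm (proj2 u (S x)) \<le> (2 * C) * norm x" for x
    using norm_proj2_le[OF unit, of "S x"] C[of x] by linarith
  then have "\<exists>C. \<forall>x\<in>H2 u. norm (block2 u S x) \<le> C * norm x"
    unfolding block2_def by auto
  then show ?thesis
    unfolding bounded_selfadjoint_def bounded_operator_def
    by (auto simp: block2_def H2_add H2_scaleC proj2_in_H2[OF unit] D proj2_add proj2_scaleC
        cinner_proj2_left cinner_proj2_right)
qed

text \<open>
  All block operators below have an off-diagonal entry of the form \<open>x \<mapsto> (x, b) u\<close>;
  this is their explicit action, free of the adjoint.
\<close>

lemma block_op_rank_one: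
  assumes unit: "norm u = 1" and b: "b \<in> H2 u"
  shows "block_op u \<alpha> (\<lambda>x\<in>H2 u. cinner x b *\<^sub>C u) T v
    = (of_real \<alpha> * cinner v u + cinner v b) *\<^sub>C u + (cinner v u *\<^sub>C b + T (proj2 u v))"
  using b unfolding block_op_def op_adjoint_rank_one[OF assms]
  by (simp add: proj1_def scaleC_scaleC proj2_in_H2[OF unit] cinner_proj2_left H1_scaleC
      cinner_scaleC_left cinner_unit[OF unit] scaleC_add_left)

lemma block_op_rank_one_unit:
  assumes unit: "norm u = 1" and b: "b \<in> H2 u" and T: "bounded_selfadjoint (H2 u) T"
  shows "block_op u \<alpha> (\<lambda>x\<in>H2 u. cinner x b *\<^sub>C u) T u = of_real \<alpha> *\<^sub>C u + b"
proof -
  have "T 0 = 0"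
    using bounded_selfadjointD(3)[OF T, of 0 0] by (simp add: H2_iff)
  moreover have "proj2 u u = 0"
    by (simp add: proj2_def proj1_def cinner_unit[OF unit])
  ultimately show ?thesis
    using b by (simp add: block_op_rank_one[OF unit b] cinner_unit[OF unit] H2_iff')
qed

lemma block2_block_op_rank_one:
  assumes unit: "norm u = 1" and b: "b \<in> H2 u" and T: "bounded_selfadjoint (H2 u) T"
    and x: "x \<in> H2 u"
  shows "block2 u (block_op u \<alpha> (\<lambda>x\<in>H2 u. cinner x b *\<^sub>C u) T) x = T x"
proof -
  have "proj2 u u = 0"
    by (simp add: proj2_def proj1_def cinner_unit[OF unit])
  moreover have "cinner x u = 0"
    using x by (simp add: H2_iff)
  ultimately show ?thesis
    using x bounded_selfadjointD(1)[OF T x]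
    by (simp add: block2_def block_op_rank_one[OF unit b] proj2_add proj2_scaleC proj2_of_H2)
qed

lemma block_op_selfadjoint:
  assumes unit: "norm u = 1" and b: "b \<in> H2 u" and T: "bounded_selfadjoint (H2 u) T"
  shows "bounded_selfadjoint UNIV (block_op u \<alpha> (\<lambda>x\<in>H2 u. cinner x b *\<^sub>C u) T)"
    (is "bounded_selfadjoint UNIV ?L")
proof -
  note D = bounded_selfadjointD[OF T proj2_in_H2[OF unit]]
  note L = block_op_rank_one[OF unit b, of \<alpha> T]
  have T0: "cinner (T (proj2 u x)) u = 0" "cinner u (T (proj2 u x)) = 0" for x
    using D(1)[of x] H2_iff[of "T (proj2 u x)" u] H2_iff'[of "T (proj2 u x)" u] by simp_all
  from bounded_selfadjoint_bound[OF T] obtain C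
    where C0: "0 \<le> C" and C: "\<And>x. x \<in> H2 u \<Longrightarrow> norm (T x) \<le> C * norm x"
    by blast
  have "norm (?L v) \<le> (\<bar>\<alpha>\<bar> + 2 * norm b + C * 2) * norm v" for v
  proof -
    have u: "cmod (cinner v u) \<le> norm v"
      using cinner_Cauchy_Schwarz[of v u] unit by simp
    have 1: "norm ((of_real \<alpha> * cinner v u + cinner v b) *\<^sub>C u) \<le> \<bar>\<alpha>\<bar> * norm v + norm b * norm v"
    proof -
      have "cmod (of_real \<alpha> * cinner v u + cinner v b) \<le> \<bar>\<alpha>\<bar> * cmod (cinner v u) + cmod (cinner v b)"
        by (metis norm_triangle_ineq norm_mult norm_of_real)
      also have "\<dots> \<le> \<bar>\<alpha>\<bar> * norm v + norm b * norm v"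
        using u cinner_Cauchy_Schwarz[of v b]
        by (intro add_mono mult_left_mono) (auto simp: mult.commute)
      finally show ?thesis
        by (simp add: norm_scaleC unit)
    qed
    have 2: "norm (cinner v u *\<^sub>C b) \<le> norm b * norm v"
      using mult_right_mono[OF u norm_ge_zero[of b]] by (simp add: norm_scaleC mult.commute)
    have "norm (T (proj2 u v)) \<le> C * norm (proj2 u v)"
      by (intro C proj2_in_H2[OF unit])
    also have "\<dots> \<le> C * (2 * norm v)"
      by (intro mult_left_mono norm_proj2_le[OF unit] C0)
    finally have 3: "norm (T (proj2 u v)) \<le> C * (2 * norm v)" .
    show ?thesis
      unfolding L
      by (intro norm_triangle_le
          order_trans[OF add_mono[OF 1 norm_triangle_le[OF add_mono[OF 2 3]]]])
        (simp add: algebra_simps)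
  qed
  then have bound: "\<exists>C. \<forall>v. norm (?L v) \<le> C * norm v"
    by blast
  have sym: "cinner (?L x) y = cinner x (?L y)" for x y
  proof -
    have "cinner (T (proj2 u x)) y = cinner (T (proj2 u x)) (proj2 u y)"
      using D(1) by (simp add: cinner_proj2_right)
    also have "\<dots> = cinner (proj2 u x) (T (proj2 u y))"
      using D(4) proj2_in_H2[OF unit] by blast
    also have "\<dots> = cinner x (T (proj2 u y))"
      using D(1) by (simp add: cinner_proj2_left)
    finally show ?thesis
      unfolding L
      by (simp add: cinner_add_left cinner_add_right cinner_scaleC_left cinner_scaleC_right
          cinner_commute[of u y] cinner_commute[of b y] algebra_simps)
  qed
  show ?thesis
    unfolding bounded_selfadjoint_def bounded_operator_def
    using bound sym
    by (simp add: L cinner_add_left cinner_scaleC_left proj2_add proj2_scaleC D(2,3)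
        proj2_in_H2[OF unit] scaleC_add_left scaleC_add_right scaleC_scaleC algebra_simps)
qed

text \<open>
  The corner entry \<open>block1 u S\<close> is a real part, which loses nothing because \<open>(S u, u)\<close> is real;
  the lower left entry is the adjoint of the upper right one because \<open>S\<close> is self-adjoint.
\<close>

lemma block_op_blocks:
  assumes unit: "norm u = 1" and S: "bounded_selfadjoint UNIV S"
  shows "block_op u (block1 u S) (block12 u S) (block2 u S) = S"
proof
  fix v
  note D = bounded_selfadjointD[OF S, simplified]
  let ?b = "proj2 u (S u)" and ?x = "proj2 u v" and ?c = "cinner v u"
  have "cinner (S u) u = cnj (cinner (S u) u)"
    using D(4)[of u u] cinner_commute[of u "S u"] by simp
  then have real: "of_real (block1 u S) = cinner (S u) u"
    unfolding block1_def by (metis Reals_cnj_iff of_real_Re)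
  have Sx: "cinner (S ?x) u = cinner v ?b"
    using D(4)[of ?x u] cinner_proj2_right[OF proj2_in_H2[OF unit], of v "S u"]
      cinner_proj2_left[OF proj2_in_H2[OF unit], of v "S u"] by simp
  have "S v = ?c *\<^sub>C S u + S ?x"
    using proj_decomposition[of v u] D(2,3) by metis
  also have "\<dots> = ?c *\<^sub>C (cinner (S u) u *\<^sub>C u + ?b) + (cinner (S ?x) u *\<^sub>C u + proj2 u (S ?x))"
    by (simp only: proj_decomposition)
  also have "\<dots> = block_op u (block1 u S) (block12 u S) (block2 u S) v"
    unfolding block12_selfadjoint[OF S] block_op_rank_one[OF unit proj2_in_H2[OF unit]] real Sx
    by (simp add: block2_def proj2_in_H2[OF unit] scaleC_add_right scaleC_add_left scaleC_scaleC
        mult.commute)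
  finally show "block_op u (block1 u S) (block12 u S) (block2 u S) v = S v" ..
qed

section \<open>The Schur complement\<close>

text \<open>
  The operator \<open>A\<^sub>1\<^sub>2 - B\<^sub>1\<^sub>2\<close> is \<open>x \<mapsto> (x, d) u\<close> with \<open>d\<close> the projection of \<open>A u - B u\<close> to \<open>H2 u\<close>;
  composed with its adjoint it becomes \<open>x \<mapsto> (x, d) d\<close>, whose form is \<open>|(x, d)|\<^sup>2\<close>.
\<close>

lemma reduced_op_form:
  assumes unit: "norm u = 1"
    and A: "bounded_selfadjoint UNIV A" and B: "bounded_selfadjoint UNIV B" and x: "x \<in> H2 u"
  shows "Re (cinner (reduced_op u \<alpha> B A x) x)
    = Re (cinner (A x) x) - mp_inverse (block1 u A - \<alpha>) * (cmod (cinner (A u - B u) x))\<^sup>2"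
proof -
  define d where "d = proj2 u (A u - B u)"
  have d: "d \<in> H2 u"
    unfolding d_def by (rule proj2_in_H2[OF unit])
  have D: "(\<lambda>y\<in>H2 u. block12 u A y - block12 u B y) = (\<lambda>y\<in>H2 u. cinner y d *\<^sub>C u)"
    by (auto simp: block12_selfadjoint[OF A] block12_selfadjoint[OF B] d_def proj2_diff
        cinner_diff_right scaleC_diff_left)
  have "reduced_op u \<alpha> B A x
      = proj2 u (A x) - of_real (mp_inverse (block1 u A - \<alpha>)) *\<^sub>C (cinner x d *\<^sub>C d)"
    using x by (simp add: reduced_op_def Let_def D op_adjoint_rank_one[OF unit d] block2_def
        H1_scaleC cinner_scaleC_left cinner_unit[OF unit])
  moreover have "cinner (cinner x d *\<^sub>C d) x = of_real ((cmod (cinner d x))\<^sup>2)"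
    by (simp only: cinner_scaleC_left cinner_commute[of x d] complex_norm_square mult.commute)
  moreover have "cinner d x = cinner (A u - B u) x"
    unfolding d_def by (rule cinner_proj2_left[OF x])
  ultimately show ?thesis
    using x by (simp add: cinner_diff_left cinner_scaleC_left cinner_proj2_left)
qed

text \<open>
  The form of \<open>A - L\<close> at \<open>c *\<^sub>C u + x\<close> with \<open>x \<in> H2 u\<close> is a quadratic polynomial in \<open>c\<close>;
  minimizing it over \<open>c\<close> leaves the form of the Schur complement at \<open>x\<close>.
\<close>

lemma loewner_le_iff_reduced:
  assumes unit: "norm u = 1"
    and A: "bounded_selfadjoint UNIV A" and B: "bounded_selfadjoint UNIV B"
    and L: "bounded_selfadjoint UNIV L"
    and LB: "L u = B u" and alpha: "block1 u B = \<alpha>"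
    and ge: "\<alpha> \<le> block1 u A" and eq: "block1 u A = \<alpha> \<Longrightarrow> A u = B u"
  shows "loewner_le UNIV L A \<longleftrightarrow> loewner_le (H2 u) (block2 u L) (reduced_op u \<alpha> B A)"
proof -
  define E where "E = (\<lambda>x. A x - L x)"
  have E: "bounded_selfadjoint UNIV E"
    unfolding E_def by (rule bounded_selfadjoint_UNIV_diff[OF A L])
  define t where "t = block1 u A - \<alpha>"
  have t: "Re (cinner (E u) u) = t"
    using alpha by (simp add: E_def t_def LB cinner_diff_left block1_def)
  have "loewner_le UNIV L A \<longleftrightarrow> (\<forall>v. 0 \<le> Re (cinner (E v) v))"
    by (simp add: loewner_le_def E_def cinner_diff_left)
  also have "\<dots> \<longleftrightarrow> (\<forall>x\<in>H2 u. \<forall>c. 0 \<le> Re (cinner (E (c *\<^sub>C u + x)) (c *\<^sub>C u + x)))"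
    by (metis proj_decomposition proj2_in_H2[OF unit])
  also have "\<dots> \<longleftrightarrow> (\<forall>x\<in>H2 u. \<forall>c. 0 \<le> t * (cmod c)\<^sup>2 + 2 * Re (c * cinner (E u) x)
      + Re (cinner (E x) x))"
    unfolding selfadjoint_quadratic_form[OF E] t ..
  also have "\<dots> \<longleftrightarrow> (\<forall>x\<in>H2 u. mp_inverse t * (cmod (cinner (E u) x))\<^sup>2 \<le> Re (cinner (E x) x))"
  proof (intro ball_cong refl quadratic_form_nonneg_iff)
    show "0 \<le> t"
      using ge by (simp add: t_def)
    show "cinner (E u) x = 0" if "t = 0" for x
      using eq that by (simp add: t_def E_def LB)
  qed
  also have "\<dots> \<longleftrightarrow> loewner_le (H2 u) (block2 u L) (reduced_op u \<alpha> B A)"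
    unfolding loewner_le_def
    by (intro ball_cong refl)
      (auto simp: reduced_op_form[OF unit A B] block2_def cinner_proj2_left E_def LB t_def
        cinner_diff_left)
  finally show ?thesis .
qed

theorem theorem4p9:
  fixes \<MM> \<MM>\<^sub>u \<LL> \<LL>\<^sub>u :: "('a::complex_hilbert_space \<Rightarrow> 'a) set"
    and \<MM>' :: "('a \<Rightarrow> 'a) \<Rightarrow> ('a \<Rightarrow> 'a) set"
    and B :: "'a \<Rightarrow> 'a" and u :: 'a and \<alpha> :: real
  assumes selfadjoint: "\<And>A. A \<in> \<MM> \<Longrightarrow> bounded_selfadjoint UNIV A"
    and nonempty: "\<MM> \<noteq> {}"
    and bounded_below: "bounded_from_below UNIV \<MM>"
    and LL: "\<LL> = lower_bounds UNIV \<MM>"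
    and unit: "norm u = 1"
    and alpha: "\<alpha> = (INF A\<in>\<MM>. Re (cinner (A u) u))"
    and MM_u: "\<MM>\<^sub>u = {A \<in> \<MM>. Re (cinner (A u) u) = \<alpha>}"
    and LL_u: "\<LL>\<^sub>u = {L \<in> \<LL>. Re (cinner (L u) u) = \<alpha>}"
    and MM_u_nonempty: "\<MM>\<^sub>u \<noteq> {}"
    and agree: "\<And>A C. A \<in> \<MM>\<^sub>u \<Longrightarrow> C \<in> \<MM>\<^sub>u \<Longrightarrow> A u = C u"
    and B: "B \<in> \<MM>\<^sub>u"
    and MM': "\<And>C. \<MM>' C = reduced_op u \<alpha> C ` \<MM>"
  shows "(\<forall>C\<in>\<MM>\<^sub>u. \<MM>' C = \<MM>' B) \<and>
    (\<forall>L. L \<in> \<LL>\<^sub>u \<longleftrightarrow>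
      (\<exists>L2 \<in> lower_bounds (H2 u) (\<MM>' B). L = block_op u \<alpha> (block12 u B) L2)) \<and>
    (\<not> bounded_from_below (H2 u) (\<MM>' B) \<longrightarrow> \<LL>\<^sub>u = {})"
proof -
  have M_D: "bounded_selfadjoint UNIV A" "\<alpha> \<le> block1 u A" "block1 u A = \<alpha> \<Longrightarrow> A u = B u"
    if "A \<in> \<MM>" for A
  proof -
    \<comment> \<open>A lower bound of \<open>\<MM>\<close> bounds the forms at \<open>u\<close> from below, so \<open>\<alpha>\<close> is a genuine infimum.\<close>
    from bounded_below obtain L where "\<forall>A\<in>\<MM>. loewner_le UNIV L A"
      by (auto simp: bounded_from_below_def lower_bounds_def)
    then have "bdd_below ((\<lambda>A. Re (cinner (A u) u)) ` \<MM>)"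
      by (intro bdd_belowI2[of _ "Re (cinner (L u) u)"]) (auto simp: loewner_le_def)
    then show "\<alpha> \<le> block1 u A"
      unfolding alpha block1_def by (rule cINF_lower) fact
    show "A u = B u" if "block1 u A = \<alpha>"
      using agree B that \<open>A \<in> \<MM>\<close> by (simp add: MM_u block1_def)
    show "bounded_selfadjoint UNIV A"
      by (rule selfadjoint) fact
  qed
  have "B \<in> \<MM>" and block1_B: "block1 u B = \<alpha>"
    using B by (simp_all add: MM_u block1_def)
  note B_sa = selfadjoint[OF \<open>B \<in> \<MM>\<close>]
  define b where "b = proj2 u (B u)"
  have b: "b \<in> H2 u"
    unfolding b_def by (rule proj2_in_H2[OF unit])
  have block12_B: "block12 u B = (\<lambda>x\<in>H2 u. cinner x b *\<^sub>C u)"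
    unfolding b_def by (rule block12_selfadjoint[OF B_sa])

  have independent: "\<MM>' C = \<MM>' B" if "C \<in> \<MM>\<^sub>u" for C
  proof -
    have "bounded_selfadjoint UNIV C" and "C u = B u"
      using that agree B selfadjoint by (auto simp: MM_u)
    then have "block12 u C = block12 u B"
      by (simp add: block12_selfadjoint B_sa)
    then have "reduced_op u \<alpha> C = reduced_op u \<alpha> B"
      by (intro ext) (simp add: reduced_op_def)
    then show ?thesis
      by (simp add: MM')
  qed

  have lower: "L \<in> \<LL> \<longleftrightarrow> block2 u L \<in> lower_bounds (H2 u) (\<MM>' B)"
    if "bounded_selfadjoint UNIV L" and "L u = B u" for L
    using that block2_selfadjoint[OF unit] loewner_le_iff_reduced[OF unit _ B_sa _ _ block1_B] M_D
    by (auto simp: LL MM' lower_bounds_def)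

  have L_u_iff: "L \<in> \<LL>\<^sub>u \<longleftrightarrow>
      (\<exists>L2 \<in> lower_bounds (H2 u) (\<MM>' B). L = block_op u \<alpha> (block12 u B) L2)" for L
  proof
    assume "L \<in> \<LL>\<^sub>u"
    then have L: "L \<in> \<LL>" "block1 u L = \<alpha>" "bounded_selfadjoint UNIV L" "loewner_le UNIV L B"
      using \<open>B \<in> \<MM>\<close> by (auto simp: LL_u LL lower_bounds_def block1_def)
    then have LB: "L u = B u"
      using block1_B by (intro loewner_le_form_eq_imp_eq[OF B_sa]) (auto simp: block1_def)
    have "block12 u L = block12 u B"
      using L LB by (simp add: block12_selfadjoint B_sa)
    then have "L = block_op u \<alpha> (block12 u B) (block2 u L)"
      using block_op_blocks[OF unit L(3)] L(2) by simp
    then show "\<exists>L2 \<in> lower_bounds (H2 u) (\<MM>' B). L = block_op u \<alpha> (block12 u B) L2"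
      using lower[OF L(3) LB] L(1) by blast
  next
    assume "\<exists>L2 \<in> lower_bounds (H2 u) (\<MM>' B). L = block_op u \<alpha> (block12 u B) L2"
    then obtain L2 where L2: "L2 \<in> lower_bounds (H2 u) (\<MM>' B)"
      and L_eq: "L = block_op u \<alpha> (\<lambda>x\<in>H2 u. cinner x b *\<^sub>C u) L2"
      by (auto simp: block12_B)
    then have L2_sa: "bounded_selfadjoint (H2 u) L2"
      by (simp add: lower_bounds_def)
    have L: "bounded_selfadjoint UNIV L"
      unfolding L_eq by (rule block_op_selfadjoint[OF unit b L2_sa])
    have "B = block_op u \<alpha> (\<lambda>x\<in>H2 u. cinner x b *\<^sub>C u) (block2 u B)"
      using block_op_blocks[OF unit B_sa] block1_B block12_B by simp
    \<comment> \<open>\<open>L\<close> and \<open>B\<close> are block operators with the same first column \<open>(\<alpha>, b)\<close>.\<close>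
    then have LB: "L u = B u"
      unfolding L_eq
      using block_op_rank_one_unit[OF unit b] L2_sa block2_selfadjoint[OF unit B_sa] by metis
    have "block2 u L x = L2 x" if "x \<in> H2 u" for x
      unfolding L_eq by (rule block2_block_op_rank_one[OF unit b L2_sa that])
    then have "block2 u L = L2"
      using bounded_selfadjoint_extensional[OF L2_sa]
      by (intro extensionalityI[of _ "H2 u"]) (auto simp: block2_def)
    then have "L \<in> \<LL>"
      using lower[OF L LB] L2 by simp
    moreover have "Re (cinner (L u) u) = \<alpha>"
      using block1_B by (simp add: LB block1_def)
    ultimately show "L \<in> \<LL>\<^sub>u"
      by (simp add: LL_u)
  qed
  then have "\<LL>\<^sub>u = {}" if "\<not> bounded_from_below (H2 u) (\<MM>' B)"
    using that by (auto simp: bounded_from_below_def)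
  with independent L_u_iff show ?thesis
    by blast
qed

end
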